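(* Suppose a linear ordering $(L,\prec)$ is $m$-dimensionally interpretable in $(\mathbb{N},+)$, where $m\ge 1$. Then $(L,\prec)$ is scattered and has $\mathit{VD}_*$-rank at most $m$.
   Context: $\mathbb{N}$ includes $0$. An $m$-dimensional interpretation $\iota$ ($m\ge 1$) of a first-order language $\mathcal{K}$ in a model $\mathfrak{M}$ consists of (parameter-free) first-order formulas of the language of $\mathfrak{M}$: $D_\iota(\overline{y})$ defining a set $\mathbf{D}_\iota\subseteq\mathfrak{M}^m$ (the domain); $P_\iota(\overline{x}_1,\ldots,\overline{x}_n)$ for each predicate symbol $P(x_1,\ldots,x_n)$ of $\mathcal{K}$, including equality; $f_\iota(\overline{x}_1,\ldots,\overline{x}_n,\overline{y})$ for each function symbol $f(x_1,\ldots,x_n)$ of $\mathcal{K}$. All vectors of variables have length $m$, and each $f_\iota$ defines the graph of a function modulo the interpretation of equality. This yields a $\mathcal{K}$-structure (the internal model) with domain $\mathbf{D}_\iota/{\sim_\iota}$, where $\sim_\iota$ is the equivalence relation given by the formula $=_\iota(\overline{x}_1,\overline{x}_2)$. A linear ordering $(L,\prec)$ is $m$-dimensionally interpretable in $(\mathbb{N},+)$ if it is (isomorphic to) the internal model of an $m$-dimensional interpretation of the language of orderings in $(\mathbb{N},+)$. A linear ordering is scattered if it does not have an infinite dense subordering. For a linear ordering $(L,\prec)$ define equivalence relations $\simeq_\alpha$ on $L$, for ordinals $\alpha$, by transfinite recursion: $\simeq_0$ is equality; $\simeq_\lambda=\bigcup_{\beta<\lambda}\simeq_\beta$ for limit ordinals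 $\lambda$; and $a\simeq_{\alpha+1}b$ iff the set $\{c\in L\mid (a\prec c\prec b)\text{ or }(b\prec c\prec a)\}/{\simeq_\alpha}$ is finite. The $\mathit{VD}_*$-rank $\mathsf{rk}(L,\prec)$ is the least ordinal $\alpha$ such that $L/{\simeq_\alpha}$ is finite; if $L/{\simeq_\alpha}$ is infinite for all ordinals $\alpha$, then $\mathsf{rk}(L,\prec)=\infty$. By definition $\alpha<\infty$ for all ordinals $\alpha$. *)

theory Defs
  imports Main "HOL-Library.Extended"
begin

section \<open>Linear orderings\<close>

definition linear_ordering :: "'a set \<Rightarrow> 'a rel \<Rightarrow> bool" where
  "linear_ordering L r \<longleftrightarrow> r \<subseteq> L \<times> L \<and> strict_linear_order_on L r"

definition dense_on :: "'a set \<Rightarrow> 'a rel \<Rightarrow> bool" where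
  "dense_on S r \<longleftrightarrow>
     (\<forall>x\<in>S. \<forall>y\<in>S. (x, y) \<in> r \<longrightarrow> (\<exists>z\<in>S. (x, z) \<in> r \<and> (z, y) \<in> r))"

definition scattered :: "'a set \<Rightarrow> 'a rel \<Rightarrow> bool" where
  "scattered L r \<longleftrightarrow> \<not> (\<exists>S\<subseteq>L. infinite S \<and> dense_on S r)"


section \<open>Interpretations of orderings in the natural numbers with addition\<close>

text \<open>First-order formulas in the language of \<open>(\<nat>, +)\<close>, with equality and named variables.
  The remaining connectives and the universal quantifier are definable.\<close>

datatype tm = Var nat | Add tm tm

datatype fm = Eq tm tm | Neg fm | Conj fm fm | Ex nat fm

primrec tm_val :: "(nat \<Rightarrow> nat) \<Rightarrow> tm \<Rightarrow> nat" where
  "tm_val e (Var i) = e i"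
| "tm_val e (Add s t) = tm_val e s + tm_val e t"

primrec sat :: "(nat \<Rightarrow> nat) \<Rightarrow> fm \<Rightarrow> bool" where
  "sat e (Eq s t) \<longleftrightarrow> tm_val e s = tm_val e t"
| "sat e (Neg \<phi>) \<longleftrightarrow> \<not> sat e \<phi>"
| "sat e (Conj \<phi> \<psi>) \<longleftrightarrow> sat e \<phi> \<and> sat e \<psi>"
| "sat e (Ex i \<phi>) \<longleftrightarrow> (\<exists>n. sat (e(i := n)) \<phi>)"

primrec tm_vars :: "tm \<Rightarrow> nat set" where
  "tm_vars (Var i) = {i}"
| "tm_vars (Add s t) = tm_vars s \<union> tm_vars t"

primrec free_vars :: "fm \<Rightarrow> nat set" where
  "free_vars (Eq s t) = tm_vars s \<union> tm_vars t"
| "free_vars (Neg \<phi>) = free_vars \<phi>"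
| "free_vars (Conj \<phi> \<psi>) = free_vars \<phi> \<union> free_vars \<psi>"
| "free_vars (Ex i \<phi>) = free_vars \<phi> - {i}"

text \<open>\<open>holds \<phi> xs\<close>: the formula \<open>\<phi>\<close> is true when its variables \<open>0, 1, \<dots>\<close> take the values
  listed in \<open>xs\<close>. It is only used when all free variables of \<open>\<phi>\<close> are below \<open>length xs\<close>, so the
  value \<open>0\<close> given to the other variables plays no role.\<close>

definition holds :: "fm \<Rightarrow> nat list \<Rightarrow> bool" where
  "holds \<phi> xs \<longleftrightarrow> sat (\<lambda>i. if i < length xs then xs ! i else 0) \<phi>"

text \<open>The language of orderings has the predicate symbols \<open>=\<close> and \<open><\<close> and no function symbols.
  Elements of \<open>\<nat>\<^sup>m\<close> are lists of length \<open>m\<close>. In a formula for a binary predicate, the variables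
  below \<open>m\<close> stand for the first argument and those from \<open>m\<close> to \<open>2m - 1\<close> for the second.\<close>

record order_interp =
  dom_fm :: fm
  eq_fm :: fm
  less_fm :: fm

definition interp_dom :: "nat \<Rightarrow> order_interp \<Rightarrow> nat list set" where
  "interp_dom m \<iota> = {xs. length xs = m \<and> holds (dom_fm \<iota>) xs}"

definition interp_eq :: "nat \<Rightarrow> order_interp \<Rightarrow> nat list rel" where
  "interp_eq m \<iota> =
     {(xs, ys). xs \<in> interp_dom m \<iota> \<and> ys \<in> interp_dom m \<iota> \<and> holds (eq_fm \<iota>) (xs @ ys)}"

definition is_interpretation :: "nat \<Rightarrow> order_interp \<Rightarrow> bool" where
  "is_interpretation m \<iota> \<longleftrightarrow>
     free_vars (dom_fm \<iota>) \<subseteq> {..<m} \<and>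
     free_vars (eq_fm \<iota>) \<subseteq> {..<2 * m} \<and>
     free_vars (less_fm \<iota>) \<subseteq> {..<2 * m} \<and>
     equiv (interp_dom m \<iota>) (interp_eq m \<iota>) \<and>
     (\<lambda>xs ys. holds (less_fm \<iota>) (xs @ ys)) respects2 (interp_eq m \<iota>)"

definition internal_carrier :: "nat \<Rightarrow> order_interp \<Rightarrow> nat list set set" where
  "internal_carrier m \<iota> = interp_dom m \<iota> // interp_eq m \<iota>"

definition internal_less :: "nat \<Rightarrow> order_interp \<Rightarrow> nat list set rel" where
  "internal_less m \<iota> =
     {(interp_eq m \<iota> `` {xs}, interp_eq m \<iota> `` {ys}) | xs ys.
        xs \<in> interp_dom m \<iota> \<and> ys \<in> interp_dom m \<iota> \<and> holds (less_fm \<iota>) (xs @ ys)}"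

definition order_isomorphic :: "'a set \<Rightarrow> 'a rel \<Rightarrow> 'b set \<Rightarrow> 'b rel \<Rightarrow> bool" where
  "order_isomorphic A r B s \<longleftrightarrow>
     (\<exists>h. bij_betw h A B \<and> (\<forall>x\<in>A. \<forall>y\<in>A. (x, y) \<in> r \<longleftrightarrow> (h x, h y) \<in> s))"

definition interpretable_in_nat_plus :: "nat \<Rightarrow> 'a set \<Rightarrow> 'a rel \<Rightarrow> bool" where
  "interpretable_in_nat_plus m L r \<longleftrightarrow>
     (\<exists>\<iota>. is_interpretation m \<iota> \<and>
          order_isomorphic L r (internal_carrier m \<iota>) (internal_less m \<iota>))"


section \<open>Ordinals\<close>

text \<open>HOL has no type of all ordinals. The type \<open>'a ordinal\<close> consists of the ordinals below
  \<open>\<kappa>\<^sup>+\<close>, where \<open>\<kappa>\<close> is the cardinality of \<open>'a + nat\<close>. For a linear ordering on a subset of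
  \<open>'a\<close>, the relations \<open>\<simeq>\<^sub>\<alpha>\<close> are constant from some \<open>\<alpha> < \<kappa>\<^sup>+\<close> on
  (lemma \<open>vd_eq_stabilizes\<close> below), so larger ordinals do not affect the rank.\<close>

definition ordinal_rel :: "('a + nat) set rel" where
  "ordinal_rel = cardSuc (card_of UNIV)"

lemma Card_order_ordinal_rel: "Card_order ordinal_rel"
  unfolding ordinal_rel_def by (intro cardSuc_Card_order card_of_Card_order)

lemma Well_order_ordinal_rel: "Well_order ordinal_rel"
  using Card_order_ordinal_rel card_order_on_well_order_on by blast

lemma infinite_Field_ordinal_rel: "infinite (Field (ordinal_rel :: ('a + nat) set rel))"
  unfolding ordinal_rel_def card_of_cardSuc_finite by simp

typedef 'a ordinal = "Field (ordinal_rel :: ('a + nat) set rel)"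
  using infinite_Field_ordinal_rel by (metis ex_in_conv finite.emptyI)

instantiation ordinal :: (type) wellorder
begin

definition less_eq_ordinal :: "'a ordinal \<Rightarrow> 'a ordinal \<Rightarrow> bool" where
  "\<alpha> \<le> \<beta> \<longleftrightarrow> (Rep_ordinal \<alpha>, Rep_ordinal \<beta>) \<in> ordinal_rel"

definition less_ordinal :: "'a ordinal \<Rightarrow> 'a ordinal \<Rightarrow> bool" where
  "(\<alpha> :: 'a ordinal) < \<beta> \<longleftrightarrow> \<alpha> \<le> \<beta> \<and> \<alpha> \<noteq> \<beta>"

instance
proof -
  let ?r = "ordinal_rel :: ('a + nat) set rel"
  have lin: "refl_on (Field ?r) ?r" "trans ?r" "antisym ?r" "total_on (Field ?r) ?r"
    and wf: "wf (?r - Id)"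
    using Well_order_ordinal_rel[where ?'a = 'a] by (auto simp: order_on_defs)
  have anti: "\<alpha> = \<beta>" if "\<alpha> \<le> \<beta>" "\<beta> \<le> \<alpha>" for \<alpha> \<beta> :: "'a ordinal"
    using that antisymD[OF lin(3)] by (metis less_eq_ordinal_def Rep_ordinal_inject)
  have refl: "\<alpha> \<le> \<alpha>" for \<alpha> :: "'a ordinal"
    using lin(1) Rep_ordinal by (auto simp: less_eq_ordinal_def refl_on_def)
  have wfo: "wf {(\<alpha>, \<beta> :: 'a ordinal). \<alpha> < \<beta>}"
    by (rule wf_subset[OF wf_inv_image[OF wf, of Rep_ordinal]])
      (auto simp: inv_image_def less_ordinal_def less_eq_ordinal_def Rep_ordinal_inject)
  show "OFCLASS('a ordinal, wellorder_class)"
  proof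
    fix \<alpha> \<beta> \<gamma> :: "'a ordinal"
    show "\<alpha> < \<beta> \<longleftrightarrow> \<alpha> \<le> \<beta> \<and> \<not> \<beta> \<le> \<alpha>"
      using anti refl by (auto simp: less_ordinal_def)
    show "\<alpha> \<le> \<alpha>" by (rule refl)
    show "\<alpha> \<le> \<gamma>" if "\<alpha> \<le> \<beta>" "\<beta> \<le> \<gamma>"
      using that transD[OF lin(2)] by (auto simp: less_eq_ordinal_def)
    show "\<alpha> = \<beta>" if "\<alpha> \<le> \<beta>" "\<beta> \<le> \<alpha>" using anti that .
    show "\<alpha> \<le> \<beta> \<or> \<beta> \<le> \<alpha>"
      using lin(4) refl Rep_ordinal[of \<alpha>] Rep_ordinal[of \<beta>]
      by (metis less_eq_ordinal_def total_on_def Rep_ordinal_inject)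
    show "P \<alpha>" if "\<And>\<alpha>. (\<And>\<beta>. \<beta> < \<alpha> \<Longrightarrow> P \<beta>) \<Longrightarrow> P \<alpha>" for P
      using wf_induct[OF wfo, of P \<alpha>] that by auto
  qed
qed

end

lemma card_of_UNIV_ordinal:
  "(card_of (UNIV :: 'a ordinal set), ordinal_rel :: ('a + nat) set rel) \<in> ordIso"
proof -
  have "bij_betw Rep_ordinal (UNIV :: 'a ordinal set) (Field (ordinal_rel :: ('a + nat) set rel))"
    by (metis Rep_ordinal_inject bij_betw_def inj_on_def type_definition.Rep_range
        type_definition_ordinal)
  then show ?thesis
    using card_of_ordIso card_of_Field_ordIso[OF Card_order_ordinal_rel] ordIso_transitive by blast
qed

lemma ordinal_no_max: "\<exists>\<beta>. \<alpha> < (\<beta> :: 'a ordinal)"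
proof -
  let ?r = "ordinal_rel :: ('a + nat) set rel"
  obtain b where "b \<in> Field ?r" "b \<noteq> Rep_ordinal \<alpha>" "(Rep_ordinal \<alpha>, b) \<in> ?r"
    using infinite_Card_order_limit[OF Card_order_ordinal_rel infinite_Field_ordinal_rel
        Rep_ordinal[of \<alpha>]] by (metis)
  then show ?thesis
    by (intro exI[of _ "Abs_ordinal b"])
      (metis Abs_ordinal_inverse less_eq_ordinal_def less_ordinal_def)
qed

definition ord_succ :: "'a ordinal \<Rightarrow> 'a ordinal" where
  "ord_succ \<alpha> = (LEAST \<beta>. \<alpha> < \<beta>)"

lemma less_ord_succ: "\<alpha> < ord_succ \<alpha>"
  unfolding ord_succ_def using ordinal_no_max by (metis LeastI_ex)

lemma less_ord_succ_iff: "\<beta> < ord_succ \<alpha> \<longleftrightarrow> \<beta> \<le> \<alpha>"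
  unfolding ord_succ_def
  by (metis less_ord_succ ord_succ_def not_less_Least leI le_less_trans)

primrec ord_of_nat :: "nat \<Rightarrow> 'a ordinal" where
  "ord_of_nat 0 = (LEAST \<alpha>. True)"
| "ord_of_nat (Suc n) = ord_succ (ord_of_nat n)"

lemma ord_of_nat_0_le: "ord_of_nat 0 \<le> \<alpha>"
  by (simp add: Least_le)


section \<open>The rank\<close>

definition between :: "'a set \<Rightarrow> 'a rel \<Rightarrow> 'a \<Rightarrow> 'a \<Rightarrow> 'a set" where
  "between L r a b =
     {c \<in> L. (a, c) \<in> r \<and> (c, b) \<in> r \<or> (b, c) \<in> r \<and> (c, a) \<in> r}"

text \<open>\<open>vd_eq L r \<alpha>\<close> is the relation \<open>\<simeq>\<^sub>\<alpha>\<close>. The three clauses of the recursion are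
  the lemmas \<open>vd_eq_0\<close>, \<open>vd_eq_succ\<close> and \<open>vd_eq_limit\<close>. For \<open>S \<subseteq> L\<close>, the set
  \<open>S // vd_eq L r \<alpha>\<close> consists of the classes in \<open>L\<close> that meet \<open>S\<close>, which correspond to the
  elements of \<open>S/\<simeq>\<^sub>\<alpha>\<close>.\<close>

declare conj_cong [fundef_cong]

function vd_eq :: "'a set \<Rightarrow> 'a rel \<Rightarrow> 'a ordinal \<Rightarrow> 'a rel" where
  "vd_eq L r \<alpha> =
     (if \<alpha> = ord_of_nat 0 then Id_on L
      else if \<exists>\<beta>. \<alpha> = ord_succ \<beta>
      then {(a, b). a \<in> L \<and> b \<in> L \<and>
                    (\<exists>\<beta>. \<alpha> = ord_succ \<beta> \<and> finite (between L r a b // vd_eq L r \<beta>))}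
      else (\<Union>\<beta>\<in>{\<beta>. \<beta> < \<alpha>}. vd_eq L r \<beta>))"
  by pat_completeness auto
termination
  by (relation "inv_image {(\<alpha>, \<beta>). \<alpha> < \<beta>} (\<lambda>(L, r, \<alpha>). \<alpha>)")
    (auto simp: wf less_ord_succ)

declare vd_eq.simps [simp del]

lemma ord_succ_inject [simp]: "ord_succ \<alpha> = ord_succ \<beta> \<longleftrightarrow> \<alpha> = \<beta>"
  by (metis less_ord_succ less_ord_succ_iff order.antisym)

lemma ord_succ_neq_0: "ord_succ \<alpha> \<noteq> ord_of_nat 0"
  by (metis less_ord_succ ord_of_nat_0_le leD)

lemma vd_eq_0: "vd_eq L r (ord_of_nat 0) = Id_on L"
  by (simp add: vd_eq.simps)

lemma vd_eq_succ:
  "vd_eq L r (ord_succ \<alpha>) =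
     {(a, b). a \<in> L \<and> b \<in> L \<and> finite (between L r a b // vd_eq L r \<alpha>)}"
  using ord_succ_neq_0[of \<alpha>] by (subst vd_eq.simps) auto

lemma vd_eq_limit:
  assumes "\<alpha> \<noteq> ord_of_nat 0" "\<And>\<beta>. \<alpha> \<noteq> ord_succ \<beta>"
  shows "vd_eq L r \<alpha> = (\<Union>\<beta>\<in>{\<beta>. \<beta> < \<alpha>}. vd_eq L r \<beta>)"
  using assms by (subst vd_eq.simps) auto

lemma finite_quotient_subset: "S \<subseteq> T \<Longrightarrow> finite (T // e) \<Longrightarrow> finite (S // e)"
  by (rule finite_subset[of _ "T // e"]) (auto simp: quotient_def)

lemma between_sym: "between L r a b = between L r b a"
  by (auto simp: between_def)

lemma between_subset:
  assumes "linear_ordering L r" "c \<in> between L r a b"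
  shows "between L r a c \<subseteq> between L r a b"
proof -
  have "trans r" "irrefl r"
    using assms(1) by (auto simp: linear_ordering_def strict_linear_order_on_def)
  then show ?thesis
    using assms(2) unfolding between_def trans_def irrefl_def by blast
qed

lemma between_triangle:
  assumes "linear_ordering L r" "b \<in> L"
  shows "between L r a c \<subseteq> between L r a b \<union> (between L r b c \<union> {b})"
proof -
  have "total_on L r"
    using assms(1) by (auto simp: linear_ordering_def strict_linear_order_on_def)
  then show ?thesis
    using assms(2) unfolding between_def total_on_def by blast
qed

lemma quotient_Un: "(S \<union> T) // e = S // e \<union> T // e"
  by (auto simp: quotient_def)

lemma vd_eq_properties:
  assumes lin: "linear_ordering L r"
  shows "equiv L (vd_eq L r \<alpha>) \<and>
    (\<forall>a b c. (a, b) \<in> vd_eq L r \<alpha> \<longrightarrow> c \<in> between L r a b \<longrightarrow> (a, c) \<in> vd_eq L r \<alpha>) \<and>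
    (\<forall>\<beta>\<le>\<alpha>. vd_eq L r \<beta> \<subseteq> vd_eq L r \<alpha>)"
proof (induction \<alpha> rule: less_induct)
  case (less \<alpha>)
  have tr: "trans r" and irr: "irrefl r"
    using lin by (auto simp: linear_ordering_def strict_linear_order_on_def)
  then have empty: "between L r a a = {}" for a
    unfolding between_def trans_def irrefl_def by blast
  consider (zero) "\<alpha> = ord_of_nat 0" | (succ) \<beta> where "\<alpha> = ord_succ \<beta>"
    | (limit) "\<alpha> \<noteq> ord_of_nat 0" "\<And>\<beta>. \<alpha> \<noteq> ord_succ \<beta>"
    by blast
  then show ?case
  proof cases
    case zero
    have "equiv L (Id_on L)"
      by (auto simp: equiv_def refl_on_def sym_def trans_def)
    moreover have "\<beta> = \<alpha>" if "\<beta> \<le> \<alpha>" for \<beta>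
      using that ord_of_nat_0_le[of \<beta>] zero by (metis order.antisym)
    moreover have "vd_eq L r \<alpha> = Id_on L"
      using zero vd_eq_0 by metis
    ultimately show ?thesis
      using empty by auto
  next
    case (succ \<beta>)
    let ?E = "vd_eq L r \<beta>"
    have IH: "equiv L ?E" "\<And>a b c. (a, b) \<in> ?E \<Longrightarrow> c \<in> between L r a b \<Longrightarrow> (a, c) \<in> ?E"
      "\<And>\<gamma>. \<gamma> \<le> \<beta> \<Longrightarrow> vd_eq L r \<gamma> \<subseteq> ?E"
      using less.IH[of \<beta>] less_ord_succ[of \<beta>] succ by blast+
    have fin: "finite (between L r a c // ?E)"
      if "finite (between L r a b // ?E)" "finite (between L r b c // ?E)" "b \<in> L" for a b c
      by (rule finite_quotient_subset[OF between_triangle[OF lin \<open>b \<in> L\<close>]])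
        (use that in \<open>simp add: quotient_Un singleton_quotient del: Un_insert_right\<close>)
    have "equiv L (vd_eq L r \<alpha>)"
      unfolding succ vd_eq_succ
    proof (rule equivI)
      show "trans {(a, b). a \<in> L \<and> b \<in> L \<and> finite (between L r a b // ?E)}"
        using fin by (auto intro!: transI)
    qed (auto simp: refl_on_def sym_def empty between_sym)
    moreover have "(a, c) \<in> vd_eq L r \<alpha>" if "(a, b) \<in> vd_eq L r \<alpha>" "c \<in> between L r a b" for a b c
    proof -
      have "c \<in> L" using that(2) by (simp add: between_def)
      then show ?thesis
        using that finite_quotient_subset[OF between_subset[OF lin that(2)]]
        by (auto simp: succ vd_eq_succ)
    qed
    moreover have "?E \<subseteq> vd_eq L r \<alpha>"
    proof (clarify)
      fix a b assume ab: "(a, b) \<in> ?E"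
      have "between L r a b // ?E \<subseteq> {?E `` {a}}"
        using IH(1) IH(2)[OF ab] by (auto simp: quotient_def dest: equiv_class_eq)
      then have "finite (between L r a b // ?E)"
        using finite_subset by blast
      then show "(a, b) \<in> vd_eq L r \<alpha>"
        using ab IH(1) by (auto simp: succ vd_eq_succ equiv_def)
    qed
    then have "vd_eq L r \<gamma> \<subseteq> vd_eq L r \<alpha>" if "\<gamma> \<le> \<alpha>" for \<gamma>
      using that IH(3)[of \<gamma>] less_ord_succ_iff[of \<gamma> \<beta>] succ by (cases "\<gamma> = \<alpha>") auto
    ultimately show ?thesis by blast
  next
    case limit
    let ?U = "\<Union>\<beta>\<in>{\<beta>. \<beta> < \<alpha>}. vd_eq L r \<beta>"
    have E: "vd_eq L r \<alpha> = ?U" by (rule vd_eq_limit[OF limit])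
    have pos: "ord_of_nat 0 < \<alpha>"
      using limit(1) ord_of_nat_0_le[of \<alpha>] by simp
    have IHe: "equiv L (vd_eq L r \<beta>)" if "\<beta> < \<alpha>" for \<beta>
      using less.IH[OF that] by blast
    have IHm: "vd_eq L r \<gamma> \<subseteq> vd_eq L r \<beta>" if "\<beta> < \<alpha>" "\<gamma> \<le> \<beta>" for \<beta> \<gamma>
      using less.IH[OF that(1)] that(2) by blast
    have "equiv L ?U"
    proof (rule equivI)
      show "?U \<subseteq> L \<times> L" using IHe by (auto simp: equiv_def)
      show "refl_on L ?U"
        using pos IHe[OF pos] by (auto simp: refl_on_def equiv_def)
      show "sym ?U" using IHe by (fastforce simp: sym_def equiv_def)
      show "trans ?U"
      proof (rule transI)
        fix a b c assume "(a, b) \<in> ?U" "(b, c) \<in> ?U"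
        then obtain \<beta> \<gamma> where "\<beta> < \<alpha>" "\<gamma> < \<alpha>" "(a, b) \<in> vd_eq L r \<beta>" "(b, c) \<in> vd_eq L r \<gamma>"
          by blast
        then have "max \<beta> \<gamma> < \<alpha>" "(a, b) \<in> vd_eq L r (max \<beta> \<gamma>)" "(b, c) \<in> vd_eq L r (max \<beta> \<gamma>)"
          using IHm[of "max \<beta> \<gamma>" \<beta>] IHm[of "max \<beta> \<gamma>" \<gamma>] by auto
        then obtain \<delta> where "\<delta> < \<alpha>" "(a, b) \<in> vd_eq L r \<delta>" "(b, c) \<in> vd_eq L r \<delta>"
          by blast
        then show "(a, c) \<in> ?U"
          using IHe[of \<delta>] unfolding equiv_def trans_def by blast
      qed
    qed
    moreover have "(a, c) \<in> ?U" if "(a, b) \<in> ?U" "c \<in> between L r a b" for a b c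
      using that less.IH by blast
    moreover have "vd_eq L r \<gamma> \<subseteq> vd_eq L r \<alpha>" if "\<gamma> \<le> \<alpha>" for \<gamma>
      using that E by (cases "\<gamma> = \<alpha>") auto
    ultimately show ?thesis unfolding E by blast
  qed
qed

lemma vd_eq_mono: "linear_ordering L r \<Longrightarrow> \<alpha> \<le> \<beta> \<Longrightarrow> vd_eq L r \<alpha> \<subseteq> vd_eq L r \<beta>"
  using vd_eq_properties by blast

lemma vd_eq_stabilizes:
  fixes L :: "'a set"
  assumes lin: "linear_ordering L r"
  shows "\<exists>\<alpha>. \<forall>\<beta>\<ge>\<alpha>. vd_eq L r \<beta> = vd_eq L r \<alpha>"
proof -
  have "\<exists>\<alpha>. vd_eq L r (ord_succ \<alpha>) = vd_eq L r \<alpha>"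
  proof (rule ccontr)
    assume "\<nexists>\<alpha>. vd_eq L r (ord_succ \<alpha>) = vd_eq L r \<alpha>"
    then have "\<exists>p. p \<in> vd_eq L r (ord_succ \<alpha>) \<and> p \<notin> vd_eq L r \<alpha>" for \<alpha>
      using vd_eq_mono[OF lin, of \<alpha> "ord_succ \<alpha>"] less_ord_succ[of \<alpha>] by (metis less_imp_le subsetI subset_antisym)
    then obtain p where p: "\<And>\<alpha>. p \<alpha> \<in> vd_eq L r (ord_succ \<alpha>)" "\<And>\<alpha>. p \<alpha> \<notin> vd_eq L r \<alpha>"
      by metis
    have "p \<alpha> \<noteq> p \<beta>" if "\<alpha> < \<beta>" for \<alpha> \<beta>
    proof -
      have "ord_succ \<alpha> \<le> \<beta>"
        using that by (metis less_ord_succ_iff leI leD)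
      then show ?thesis
        using p vd_eq_mono[OF lin, of "ord_succ \<alpha>" \<beta>] by (metis subsetD)
    qed
    then have "inj p"
      by (metis injI neq_iff)
    then have 1: "(card_of (UNIV :: 'a ordinal set), card_of (UNIV :: ('a \<times> 'a) set)) \<in> ordLeq"
      by (intro iffD1[OF card_of_ordLeq] exI[of _ p]) auto
    have "inj (map_prod Inl Inl :: 'a \<times> 'a \<Rightarrow> ('a + nat) \<times> ('a + nat))"
      by (intro prod.inj_map inj_Inl)
    then have 2: "(card_of (UNIV :: ('a \<times> 'a) set), card_of (UNIV :: (('a + nat) \<times> ('a + nat)) set)) \<in> ordLeq"
      by (intro iffD1[OF card_of_ordLeq] exI) auto
    have 3: "(card_of (UNIV :: (('a + nat) \<times> ('a + nat)) set), card_of (UNIV :: ('a + nat) set)) \<in> ordIso"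
      using card_of_Times_same_infinite[of "UNIV :: ('a + nat) set"] by simp
    have 4: "(card_of (UNIV :: ('a + nat) set), ordinal_rel :: ('a + nat) set rel) \<in> ordLess"
      unfolding ordinal_rel_def by (rule cardSuc_greater[OF card_of_Card_order])
    have "(ordinal_rel :: ('a + nat) set rel, ordinal_rel :: ('a + nat) set rel) \<in> ordLess"
      using ordIso_symmetric[OF card_of_UNIV_ordinal[where 'a = 'a]] 1 2 3 4
      by (meson ordIso_ordLeq_trans ordLeq_transitive ordLeq_ordIso_trans ordLeq_ordLess_trans)
    then show False
      using ordLess_irreflexive by blast
  qed
  then obtain \<alpha> where \<alpha>: "vd_eq L r (ord_succ \<alpha>) = vd_eq L r \<alpha>" by blast
  have "\<alpha> \<le> \<beta> \<longrightarrow> vd_eq L r \<beta> = vd_eq L r \<alpha>" for \<beta>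
  proof (induction \<beta> rule: less_induct)
    case (less \<beta>)
    consider "\<beta> \<le> \<alpha>" | (succ) \<gamma> where "\<alpha> < \<beta>" "\<beta> = ord_succ \<gamma>"
      | (limit) "\<alpha> < \<beta>" "\<And>\<gamma>. \<beta> \<noteq> ord_succ \<gamma>"
      by (metis leI)
    then show ?case
    proof cases
      case 1
      then show ?thesis by auto
    next
      case (succ \<gamma>)
      then have "vd_eq L r \<gamma> = vd_eq L r \<alpha>"
        using less.IH[of \<gamma>] less_ord_succ[of \<gamma>] less_ord_succ_iff[of \<alpha> \<gamma>] by blast
      then show ?thesis
        using \<alpha> by (simp add: succ vd_eq_succ)
    next
      case limit
      have "\<beta> \<noteq> ord_of_nat 0"
        using limit(1) ord_of_nat_0_le[of \<alpha>] by auto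
      then have E: "vd_eq L r \<beta> = (\<Union>\<gamma>\<in>{\<gamma>. \<gamma> < \<beta>}. vd_eq L r \<gamma>)"
        by (rule vd_eq_limit[OF _ limit(2)])
      have "vd_eq L r \<gamma> \<subseteq> vd_eq L r \<alpha>" if "\<gamma> < \<beta>" for \<gamma>
        using less.IH[OF that] vd_eq_mono[OF lin, of \<gamma> \<alpha>] by (cases "\<alpha> \<le> \<gamma>") auto
      then show ?thesis
        using limit(1) by (auto simp: E)
    qed
  qed
  then show ?thesis by blast
qed

definition vd_rank :: "'a set \<Rightarrow> 'a rel \<Rightarrow> 'a ordinal extended" where
  "vd_rank L r =
     (if \<exists>\<alpha>. finite (L // vd_eq L r \<alpha>)
      then Fin (LEAST \<alpha>. finite (L // vd_eq L r \<alpha>)) else \<infinity>)"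

end

theory Submission
  imports Defs "HOL-Decision_Procs.Cooper"
begin

text \<open>By quantifier elimination, the initial segments \<open>{c. c \<prec> a}\<close> are defined by linear
  inequalities and congruences in \<open>c\<close> in which only the thresholds depend on \<open>a\<close>. Moving a
  threshold changes such a set inside finitely many parallel hyperplanes. Hence, within a set of
  dimension \<open>k\<close>, the initial segments fall into finitely many types modulo sets of dimension
  less than \<open>k\<close>, and the interval between two points of the same type has dimension less than
  \<open>k\<close>. Both claims follow by induction on the dimension. The argument applies to arbitrary
  subsets of \<open>\<nat>\<^sup>m\<close>, definable or not, so any choice of representatives of the classes
  of the interpreted equality will do.\<close>

section \<open>Flats and thin sets\<close>

text \<open>A flat has affine dimension at most \<open>card I\<close>: on it, the coordinates with indices in
  \<open>I\<close> affinely determine all linear functionals. Thin sets have dimension strictly below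
  \<open>k\<close>, so that only the empty set is thin for \<open>k = 0\<close>.\<close>

definition flat :: "('a \<Rightarrow> nat \<Rightarrow> int) \<Rightarrow> nat \<Rightarrow> nat set \<Rightarrow> 'a set \<Rightarrow> bool" where
  "flat x m I V \<longleftrightarrow> finite I \<and>
     (\<forall>c :: nat \<Rightarrow> real. \<exists>q q0. \<forall>a\<in>V.
        (\<Sum>i<m. c i * real_of_int (x a i)) = q0 + (\<Sum>i\<in>I. q i * real_of_int (x a i)))"

definition thin :: "('a \<Rightarrow> nat \<Rightarrow> int) \<Rightarrow> nat \<Rightarrow> nat \<Rightarrow> 'a set \<Rightarrow> bool" where
  "thin x m k S \<longleftrightarrow>
     (\<exists>\<V>. finite \<V> \<and> S \<subseteq> \<Union>\<V> \<and> (\<forall>V\<in>\<V>. \<exists>I. flat x m I V \<and> card I < k))"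

lemma flat_all_coordinates: "flat x m {..<m} V"
  unfolding flat_def
proof (intro conjI allI)
  fix c :: "nat \<Rightarrow> real"
  show "\<exists>q q0. \<forall>a\<in>V. (\<Sum>i<m. c i * real_of_int (x a i)) = q0 + (\<Sum>i<m. q i * real_of_int (x a i))"
    by (intro exI[of _ c] exI[of _ 0]) simp
qed simp

lemma flat_hyperplane:
  fixes c :: "nat \<Rightarrow> int"
  assumes fl: "flat x m I V"
    and nonconst: "a \<in> V" "b \<in> V" "(\<Sum>i<m. c i * x a i) \<noteq> (\<Sum>i<m. c i * x b i)"
  shows "\<exists>j\<in>I. flat x m (I - {j}) {v \<in> V. (\<Sum>i<m. c i * x v i) = t}"
proof -
  have fin: "finite I" using fl by (simp add: flat_def)
  obtain q q0 where q: "\<And>v. v \<in> V \<Longrightarrow> (\<Sum>i<m. real_of_int (c i) * real_of_int (x v i))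
      = q0 + (\<Sum>i\<in>I. q i * real_of_int (x v i))"
    using fl unfolding flat_def by (elim conjE allE[of _ "\<lambda>i. real_of_int (c i)"]) blast
  have cast: "(\<Sum>i<m. real_of_int (c i) * real_of_int (x v i)) = real_of_int (\<Sum>i<m. c i * x v i)" for v
    by simp
  obtain j where j: "j \<in> I" "q j \<noteq> 0"
  proof (rule ccontr)
    assume "\<not> thesis"
    then have "(\<Sum>i\<in>I. q i * real_of_int (x v i)) = 0" for v
      using that by (intro sum.neutral) auto
    then have "real_of_int (\<Sum>i<m. c i * x a i) = real_of_int (\<Sum>i<m. c i * x b i)"
      using q[OF nonconst(1)] q[OF nonconst(2)] unfolding cast by simp
    then show False using nonconst(3) by (simp only: of_int_eq_iff)
  qed
  let ?W = "{v \<in> V. (\<Sum>i<m. c i * x v i) = t}"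
  let ?s = "\<lambda>p v. \<Sum>i\<in>I - {j}. p i * real_of_int (x v i)"
  have split: "(\<Sum>i\<in>I. p i * real_of_int (x v i)) = p j * real_of_int (x v j) + ?s p v" for p v
    using fin j(1) by (rule sum.remove)
  have xj: "real_of_int (x v j) = (real_of_int t - q0 - ?s q v) / q j" if "v \<in> ?W" for v
  proof -
    have "real_of_int t = real_of_int (\<Sum>i<m. c i * x v i)" using that by (simp del: of_int_sum)
    also have "\<dots> = q0 + (q j * real_of_int (x v j) + ?s q v)"
      unfolding cast[symmetric] split[symmetric] using that by (intro q) simp
    finally have "real_of_int t = q0 + (q j * real_of_int (x v j) + ?s q v)" .
    then show ?thesis using j(2) by (simp add: field_simps)
  qed
  have "flat x m (I - {j}) ?W"
    unfolding flat_def
  proof (intro conjI allI)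
    fix d :: "nat \<Rightarrow> real"
    obtain p p0 where p: "\<And>v. v \<in> V \<Longrightarrow> (\<Sum>i<m. d i * real_of_int (x v i))
        = p0 + (\<Sum>i\<in>I. p i * real_of_int (x v i))"
      using fl unfolding flat_def by (elim conjE allE[of _ d]) blast
    \<comment> \<open>The new coefficients result from substituting \<open>xj\<close> for coordinate
      \<open>j\<close> in the expression of \<open>d\<close>.\<close>
    have "(\<Sum>i<m. d i * real_of_int (x v i)) =
        (p0 + p j * (real_of_int t - q0) / q j) + ?s (\<lambda>i. p i - p j / q j * q i) v" if "v \<in> ?W" for v
    proof -
      have sub: "?s (\<lambda>i. p i - p j / q j * q i) v = ?s p v - p j / q j * ?s q v"
        unfolding sum_distrib_left sum_subtractf[symmetric]
        by (rule sum.cong) (simp_all add: algebra_simps)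
      have "(\<Sum>i<m. d i * real_of_int (x v i)) = p0 + (p j * real_of_int (x v j) + ?s p v)"
        unfolding split[symmetric] using that by (intro p) simp
      also have "\<dots> = (p0 + p j * (real_of_int t - q0) / q j) + (?s p v - p j / q j * ?s q v)"
        unfolding xj[OF that] by (simp add: diff_divide_distrib right_diff_distrib)
      finally show ?thesis unfolding sub .
    qed
    then show "\<exists>q q0. \<forall>v\<in>?W. (\<Sum>i<m. d i * real_of_int (x v i)) = q0 + ?s q v"
      by (intro exI[of _ "\<lambda>i. p i - p j / q j * q i"] exI[of _ "p0 + p j * (real_of_int t - q0) / q j"])
        (rule ballI)
  qed (use fin in simp)
  then show ?thesis using j(1) by blast
qed

section \<open>Closure properties of thin sets\<close>

lemma thin_0: "thin x m 0 S \<longleftrightarrow> S = {}"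
  unfolding thin_def by (auto intro: exI[of _ "{}"])

lemma thin_empty: "thin x m k {}"
  unfolding thin_def by (intro exI[of _ "{}"]) simp

lemma thin_subset: "thin x m k S \<Longrightarrow> S' \<subseteq> S \<Longrightarrow> thin x m k S'"
  unfolding thin_def by (meson subset_trans)

lemma thin_mono: "thin x m k S \<Longrightarrow> k \<le> l \<Longrightarrow> thin x m l S"
  unfolding thin_def by (meson less_le_trans)

lemma thin_flat: "flat x m I V \<Longrightarrow> card I < k \<Longrightarrow> thin x m k V"
  unfolding thin_def by (intro exI[of _ "{V}"]) auto

lemma thin_Un:
  assumes "thin x m k S" "thin x m k S'"
  shows "thin x m k (S \<union> S')"
proof -
  obtain \<V> \<W> where "finite \<V>" "S \<subseteq> \<Union>\<V>" "\<forall>V\<in>\<V>. \<exists>I. flat x m I V \<and> card I < k"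
    "finite \<W>" "S' \<subseteq> \<Union>\<W>" "\<forall>V\<in>\<W>. \<exists>I. flat x m I V \<and> card I < k"
    using assms unfolding thin_def by blast
  then show ?thesis
    unfolding thin_def by (intro exI[of _ "\<V> \<union> \<W>"]) auto
qed

lemma thin_UN:
  assumes "finite K" "\<And>t. t \<in> K \<Longrightarrow> thin x m k (S t)"
  shows "thin x m k (\<Union>t\<in>K. S t)"
  using assms by (induction K) (auto simp: thin_empty intro: thin_Un)


section \<open>Presburger formulas have finitely many section types\<close>

text \<open>\<open>P c a\<close> is read as membership of \<open>c\<close> in the section at the parameter \<open>a\<close>; the sets in
  \<open>\<C>\<close> act as colours for the parameters.\<close>

definition finitely_many_types ::
    "('a \<Rightarrow> nat \<Rightarrow> int) \<Rightarrow> nat \<Rightarrow> ('a \<Rightarrow> 'a \<Rightarrow> bool) \<Rightarrow> bool" where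
  "finitely_many_types x m P \<longleftrightarrow>
     (\<forall>I V. flat x m I V \<longrightarrow>
        (\<exists>\<C>. finite \<C> \<and> (\<forall>a b. (\<forall>B\<in>\<C>. a \<in> B \<longleftrightarrow> b \<in> B) \<longrightarrow>
           thin x m (card I) {c \<in> V. P c a \<noteq> P c b})))"

section \<open>Boolean combinations\<close>

lemma fmt_const: "finitely_many_types x m (\<lambda>c a. Q)"
  unfolding finitely_many_types_def by (auto simp: thin_empty)

lemma fmt_not: "finitely_many_types x m P \<Longrightarrow> finitely_many_types x m (\<lambda>c a. \<not> P c a)"
  unfolding finitely_many_types_def by simp

text \<open>Where the conjunction changes between \<open>a\<close> and \<open>b\<close>, one of the
  conjuncts changes, so the union of the two colour families works.\<close>

lemma fmt_conj:
  assumes "finitely_many_types x m P" "finitely_many_types x m Q"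
  shows "finitely_many_types x m (\<lambda>c a. P c a \<and> Q c a)"
  unfolding finitely_many_types_def
proof (intro allI impI)
  fix I V assume fl: "flat x m I V"
  obtain \<C> \<D> where C: "finite \<C>" "\<And>a b. (\<forall>B\<in>\<C>. a \<in> B \<longleftrightarrow> b \<in> B) \<Longrightarrow>
      thin x m (card I) {c \<in> V. P c a \<noteq> P c b}"
    and D: "finite \<D>" "\<And>a b. (\<forall>B\<in>\<D>. a \<in> B \<longleftrightarrow> b \<in> B) \<Longrightarrow>
      thin x m (card I) {c \<in> V. Q c a \<noteq> Q c b}"
    using assms fl unfolding finitely_many_types_def by meson
  have thin: "thin x m (card I) {c \<in> V. (P c a \<and> Q c a) \<noteq> (P c b \<and> Q c b)}"
    if "\<forall>B\<in>\<C> \<union> \<D>. a \<in> B \<longleftrightarrow> b \<in> B" for a b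
  proof (rule thin_subset)
    show "thin x m (card I) ({c \<in> V. P c a \<noteq> P c b} \<union> {c \<in> V. Q c a \<noteq> Q c b})"
      using that by (intro thin_Un C D) auto
  qed auto
  show "\<exists>\<C>. finite \<C> \<and> (\<forall>a b. (\<forall>B\<in>\<C>. a \<in> B \<longleftrightarrow> b \<in> B) \<longrightarrow>
      thin x m (card I) {c \<in> V. (P c a \<and> Q c a) \<noteq> (P c b \<and> Q c b)})"
    by (intro exI[of _ "\<C> \<union> \<D>"] conjI finite_UnI C(1) D(1) allI impI) (rule thin)
qed

lemma fmt_disj:
  assumes "finitely_many_types x m P" "finitely_many_types x m Q"
  shows "finitely_many_types x m (\<lambda>c a. P c a \<or> Q c a)"
  using fmt_not[OF fmt_conj[OF fmt_not[OF assms(1)] fmt_not[OF assms(2)]]] by simp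

section \<open>Linear inequalities, equations and congruences\<close>

text \<open>On a flat, a half-space bounded by \<open>{f = t}\<close> changes only by finitely many hyperplane
  sections when \<open>t\<close> varies, unless \<open>f\<close> is constant on the flat.\<close>

lemma fmt_le:
  fixes f :: "nat \<Rightarrow> int" and g :: "'a \<Rightarrow> int"
  shows "finitely_many_types x m (\<lambda>c a. (\<Sum>i<m. f i * x c i) + g a \<le> 0)"
  unfolding finitely_many_types_def
proof (intro allI impI)
  fix I V assume fl: "flat x m I V"
  let ?f = "\<lambda>c. \<Sum>i<m. f i * x c i"
  show "\<exists>\<C>. finite \<C> \<and> (\<forall>a b. (\<forall>B\<in>\<C>. a \<in> B \<longleftrightarrow> b \<in> B) \<longrightarrow>
      thin x m (card I) {c \<in> V. (?f c + g a \<le> 0) \<noteq> (?f c + g b \<le> 0)})"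
  proof (cases "\<exists>a\<in>V. \<exists>b\<in>V. ?f a \<noteq> ?f b")
    case True
    then obtain u v where uv: "u \<in> V" "v \<in> V" "?f u \<noteq> ?f v" by blast
    have hyp: "thin x m (card I) {c \<in> V. ?f c = t}" for t
    proof -
      obtain j where "j \<in> I" "flat x m (I - {j}) {c \<in> V. ?f c = t}"
        using flat_hyperplane[OF fl uv] by blast
      moreover have "finite I" using fl by (simp add: flat_def)
      ultimately show ?thesis by (blast intro: thin_flat card_Diff1_less)
    qed
    have "thin x m (card I) {c \<in> V. (?f c + g a \<le> 0) \<noteq> (?f c + g b \<le> 0)}" for a b
    proof (rule thin_subset)
      \<comment> \<open>A change at \<open>c\<close> places the integer \<open>?f c\<close> between
        the two thresholds, which leaves finitely many values.\<close>
      show "thin x m (card I) (\<Union>t\<in>{min (- g a) (- g b)..max (- g a) (- g b)}. {c \<in> V. ?f c = t})"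
        by (intro thin_UN hyp) simp
    qed (auto simp: min_def max_def)
    \<comment> \<open>Thinness holds for all \<open>a\<close> and \<open>b\<close>, so no colours
      are required.\<close>
    then show ?thesis by (intro exI[of _ "{}"] conjI finite.emptyI allI impI)
  next
    case False
    show ?thesis
    proof (cases "V = {}")
      case True
      then show ?thesis by (intro exI[of _ "{}"]) (simp add: thin_empty)
    next
      case nonempty: False
      then obtain v where v: "v \<in> V" by blast
      \<comment> \<open>Here \<open>?f\<close> is constant on \<open>V\<close>: one colour, the
        truth of the inequality at \<open>v\<close>, decides it on all of \<open>V\<close>.\<close>
      have empty: "{c \<in> V. (?f c + g a \<le> 0) \<noteq> (?f c + g b \<le> 0)} = {}"
        if "\<forall>B\<in>{{a. ?f v + g a \<le> 0}}. a \<in> B \<longleftrightarrow> b \<in> B" for a b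
      proof -
        have "?f c = ?f v" if "c \<in> V" for c using that False v by blast
        then show ?thesis using that by auto
      qed
      have "thin x m (card I) {c \<in> V. (?f c + g a \<le> 0) \<noteq> (?f c + g b \<le> 0)}"
        if "\<forall>B\<in>{{a. ?f v + g a \<le> 0}}. a \<in> B \<longleftrightarrow> b \<in> B" for a b
        unfolding empty[OF that] by (rule thin_empty)
      then show ?thesis
        by (intro exI[of _ "{{a. ?f v + g a \<le> 0}}"] conjI finite.intros allI impI)
    qed
  qed
qed

lemma fmt_eq:
  fixes f :: "nat \<Rightarrow> int" and g :: "'a \<Rightarrow> int"
  shows "finitely_many_types x m (\<lambda>c a. (\<Sum>i<m. f i * x c i) + g a = 0)"
proof -
  have eq: "(\<Sum>i<m. f i * x c i) + g a = 0 \<longleftrightarrow>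
      (\<Sum>i<m. f i * x c i) + g a \<le> 0 \<and> (\<Sum>i<m. - f i * x c i) + - g a \<le> 0" for c a
    by (auto simp: sum_negf)
  show ?thesis
    unfolding eq by (intro fmt_conj fmt_le)
qed

text \<open>For nonzero \<open>d\<close> the condition depends on \<open>a\<close> only through the
  residue of \<open>g a\<close> modulo the absolute value of \<open>d\<close>. Colouring by residues
  makes the sections of equally coloured parameters coincide.\<close>

lemma fmt_dvd:
  fixes f :: "nat \<Rightarrow> int" and g :: "'a \<Rightarrow> int"
  shows "finitely_many_types x m (\<lambda>c a. d dvd (\<Sum>i<m. f i * x c i) + g a)"
proof (cases "d = 0")
  \<comment> \<open>Divisibility by zero is equality with zero.\<close>
  case True
  then show ?thesis using fmt_eq by simp
next
  case False
  let ?C = "(\<lambda>s. {a. g a mod \<bar>d\<bar> = s}) ` {0..<\<bar>d\<bar>}"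
  have eq: "(d dvd t + g a) = (d dvd t + g b)" if "\<forall>B\<in>?C. a \<in> B \<longleftrightarrow> b \<in> B" for a b t
  proof -
    have "g b mod \<bar>d\<bar> \<in> {0..<\<bar>d\<bar>}" using False by simp
    then have "{u. g u mod \<bar>d\<bar> = g b mod \<bar>d\<bar>} \<in> ?C" by (rule imageI)
    from bspec[OF that this] have "g a mod \<bar>d\<bar> = g b mod \<bar>d\<bar>" by (simp only: mem_Collect_eq)
    then have "\<bar>d\<bar> dvd g a - g b" by (simp only: mod_eq_dvd_iff)
    then have "d dvd g a - g b" by (simp only: abs_dvd_iff)
    then have "(d dvd (g a - g b) + (t + g b)) = (d dvd t + g b)" by (rule dvd_add_right_iff)
    moreover have "(g a - g b) + (t + g b) = t + g a" by simp
    ultimately show ?thesis by (simp only:)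
  qed
  have "thin x m k {c \<in> V. (d dvd (\<Sum>i<m. f i * x c i) + g a) \<noteq> (d dvd (\<Sum>i<m. f i * x c i) + g b)}"
    if "\<forall>B\<in>?C. a \<in> B \<longleftrightarrow> b \<in> B" for a b k V
  proof -
    have "{c \<in> V. (d dvd (\<Sum>i<m. f i * x c i) + g a) \<noteq> (d dvd (\<Sum>i<m. f i * x c i) + g b)} = {}"
      using eq[OF that] by blast
    then show ?thesis by (simp only: thin_empty)
  qed
  then show ?thesis
    unfolding finitely_many_types_def
    by (intro allI impI exI[of _ ?C] conjI finite_imageI finite_atLeastLessThan_int)
qed

section \<open>Linear terms and quantifier-free formulas\<close>

text \<open>Indices below \<open>m\<close> refer to \<open>c\<close> and contribute the coefficients
  \<open>f\<close>. All other indices depend on \<open>a\<close> alone and go into \<open>g\<close>,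
  which may be any function.\<close>

lemma Inum_affine:
  "\<exists>f g. \<forall>c a. Inum (map (x c) [0..<m] @ map (x a) [0..<m]) t = (\<Sum>i<m. f i * x c i) + g a"
proof (induction t)
  case (C k)
  show ?case by (intro exI[of _ "\<lambda>_. 0"] exI[of _ "\<lambda>_. k"]) simp
next
  case (Bound n)
  show ?case
  proof (cases "n < m")
    case True
    then show ?thesis
      by (intro exI[of _ "\<lambda>i. if i = n then 1 else 0"] exI[of _ "\<lambda>_. 0"])
        (simp add: nth_append if_distrib[of "\<lambda>u. u * _"] cong: if_cong)
  next
    case False
    \<comment> \<open>An index past the end of the environment also falls here: its value is
      unspecified, but determined by \<open>a\<close>.\<close>
    then show ?thesis
      by (intro exI[of _ "\<lambda>_. 0"] exI[of _ "\<lambda>a. map (x a) [0..<m] ! (n - m)"])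
        (simp add: nth_append)
  qed
next
  case (CN n k t)
  then obtain f g where IH: "\<And>c a. Inum (map (x c) [0..<m] @ map (x a) [0..<m]) t
      = (\<Sum>i<m. f i * x c i) + g a" by blast
  show ?case
  proof (cases "n < m")
    case True
    then show ?thesis
      by (intro exI[of _ "\<lambda>i. (if i = n then k else 0) + f i"] exI[of _ g])
        (simp add: IH nth_append distrib_right sum.distrib if_distrib[of "\<lambda>u. u * _"] cong: if_cong)
  next
    case False
    then show ?thesis
      by (intro exI[of _ f] exI[of _ "\<lambda>a. k * (map (x a) [0..<m] ! (n - m)) + g a"])
        (simp add: IH nth_append)
  qed
next
  case (Neg t)
  then obtain f g where "\<And>c a. Inum (map (x c) [0..<m] @ map (x a) [0..<m]) t
      = (\<Sum>i<m. f i * x c i) + g a" by blast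
  then show ?case
    by (intro exI[of _ "\<lambda>i. - f i"] exI[of _ "\<lambda>a. - g a"]) (simp add: sum_negf)
next
  case (Add s t)
  then obtain f g f' g' where "\<And>c a. Inum (map (x c) [0..<m] @ map (x a) [0..<m]) s
      = (\<Sum>i<m. f i * x c i) + g a" "\<And>c a. Inum (map (x c) [0..<m] @ map (x a) [0..<m]) t
      = (\<Sum>i<m. f' i * x c i) + g' a" by blast
  then show ?case
    by (intro exI[of _ "\<lambda>i. f i + f' i"] exI[of _ "\<lambda>a. g a + g' a"])
      (simp add: sum.distrib distrib_right)
next
  case (Sub s t)
  then obtain f g f' g' where "\<And>c a. Inum (map (x c) [0..<m] @ map (x a) [0..<m]) s
      = (\<Sum>i<m. f i * x c i) + g a" "\<And>c a. Inum (map (x c) [0..<m] @ map (x a) [0..<m]) t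
      = (\<Sum>i<m. f' i * x c i) + g' a" by blast
  then show ?case
    by (intro exI[of _ "\<lambda>i. f i - f' i"] exI[of _ "\<lambda>a. g a - g' a"])
      (simp add: sum_subtractf left_diff_distrib)
next
  case (Mul k t)
  then obtain f g where "\<And>c a. Inum (map (x c) [0..<m] @ map (x a) [0..<m]) t
      = (\<Sum>i<m. f i * x c i) + g a" by blast
  then show ?case
    by (intro exI[of _ "\<lambda>i. k * f i"] exI[of _ "\<lambda>a. k * g a"])
      (simp add: sum_distrib_left distrib_left mult.assoc)
qed

lemma fmt_Inum:
  fixes x :: "'a \<Rightarrow> nat \<Rightarrow> int" and m :: nat
  defines "env \<equiv> \<lambda>c a. map (x c) [0..<m] @ map (x a) [0..<m]"
  shows "finitely_many_types x m (\<lambda>c a. Inum (env c a) t \<le> 0)"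
    and "finitely_many_types x m (\<lambda>c a. Inum (env c a) t = 0)"
    and "finitely_many_types x m (\<lambda>c a. d dvd Inum (env c a) t)"
proof -
  obtain f g where t: "\<And>c a. Inum (env c a) t = (\<Sum>i<m. f i * x c i) + g a"
    using Inum_affine unfolding env_def by metis
  show "finitely_many_types x m (\<lambda>c a. Inum (env c a) t \<le> 0)"
    unfolding t by (rule fmt_le)
  show "finitely_many_types x m (\<lambda>c a. Inum (env c a) t = 0)"
    unfolding t by (rule fmt_eq)
  show "finitely_many_types x m (\<lambda>c a. d dvd Inum (env c a) t)"
    unfolding t by (rule fmt_dvd)
qed

text \<open>Up to negating a term or a formula, the arithmetic atoms are \<open>\<le>\<close>,
  equality and divisibility. Closed atoms depend only on the fixed \<open>bbs\<close>.\<close>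

lemma fmt_qfree:
  assumes "qfree p"
  shows "finitely_many_types x m (\<lambda>c a. Ifm bbs (map (x c) [0..<m] @ map (x a) [0..<m]) p)"
    (is "finitely_many_types x m (\<lambda>c a. Ifm bbs (?env c a) p)")
  using assms
proof (induction p)
  case (Lt t)
  have "Inum bs t < 0 \<longleftrightarrow> \<not> Inum bs (num.Neg t) \<le> 0" for bs by auto
  then show ?case unfolding Ifm.simps by (simp only: fmt_not fmt_Inum)
next
  case (Gt t)
  have "Inum bs t > 0 \<longleftrightarrow> \<not> Inum bs t \<le> 0" for bs by auto
  then show ?case unfolding Ifm.simps by (simp only: fmt_not fmt_Inum)
next
  case (Ge t)
  have "Inum bs t \<ge> 0 \<longleftrightarrow> Inum bs (num.Neg t) \<le> 0" for bs by auto
  then show ?case unfolding Ifm.simps by (simp only: fmt_Inum)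
next
  case (Imp p q)
  then have "finitely_many_types x m (\<lambda>c a. \<not> Ifm bbs (?env c a) p \<or> Ifm bbs (?env c a) q)"
    by (intro fmt_disj fmt_not) simp_all
  then show ?case by (simp only: Ifm.simps imp_conv_disj)
next
  case (Iff p q)
  then have "finitely_many_types x m (\<lambda>c a. (\<not> Ifm bbs (?env c a) p \<or> Ifm bbs (?env c a) q) \<and>
      (\<not> Ifm bbs (?env c a) q \<or> Ifm bbs (?env c a) p))"
    by (intro fmt_disj fmt_conj fmt_not) simp_all
  then show ?case by (simp only: Ifm.simps iff_conv_conj_imp imp_conv_disj)
next
  case (Not p)
  then show ?case unfolding Ifm.simps by (intro fmt_not) simp
next
  case (And p q)
  then show ?case unfolding Ifm.simps by (intro fmt_conj) simp_all
next
  case (Or p q)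
  then show ?case unfolding Ifm.simps by (intro fmt_disj) simp_all
next
  case (NEq t)
  show ?case unfolding Ifm.simps by (intro fmt_not fmt_Inum)
next
  case (NDvd d t)
  show ?case unfolding Ifm.simps by (intro fmt_not fmt_Inum)
next
  case (NClosed n)
  show ?case unfolding Ifm.simps by (rule fmt_const)
qed (unfold Ifm.simps, (rule fmt_const fmt_Inum | simp)+)


section \<open>Quantifier elimination\<close>

primrec num_of_tm :: "(nat \<Rightarrow> nat) \<Rightarrow> tm \<Rightarrow> Cooper.num" where
  "num_of_tm \<rho> (Var i) = Bound (\<rho> i)"
| "num_of_tm \<rho> (tm.Add s t) = num.Add (num_of_tm \<rho> s) (num_of_tm \<rho> t)"

text \<open>Cooper's formulas have de Bruijn indices and range over the integers: \<open>\<rho>\<close> maps variable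
  names to indices, and quantifiers are restricted to nonnegative values.\<close>

primrec cooper_of_fm :: "(nat \<Rightarrow> nat) \<Rightarrow> Defs.fm \<Rightarrow> Cooper.fm" where
  "cooper_of_fm \<rho> (Defs.Eq s t) = Cooper.Eq (num.Sub (num_of_tm \<rho> s) (num_of_tm \<rho> t))"
| "cooper_of_fm \<rho> (Defs.fm.Neg \<phi>) = Not (cooper_of_fm \<rho> \<phi>)"
| "cooper_of_fm \<rho> (Conj \<phi> \<psi>) = And (cooper_of_fm \<rho> \<phi>) (cooper_of_fm \<rho> \<psi>)"
| "cooper_of_fm \<rho> (Ex i \<phi>) =
     E (And (Ge (Bound 0)) (cooper_of_fm (\<lambda>j. if j = i then 0 else Suc (\<rho> j)) \<phi>))"

lemma Inum_num_of_tm: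
  "\<forall>i\<in>tm_vars t. bs ! \<rho> i = int (e i) \<Longrightarrow> Inum bs (num_of_tm \<rho> t) = int (tm_val e t)"
  by (induction t) auto

text \<open>The induction generalises over \<open>\<rho>\<close>, \<open>bs\<close> and
  \<open>e\<close> because a quantifier prepends a value to \<open>bs\<close> and shifts the indices
  of the other variables.\<close>

lemma Ifm_cooper_of_fm:
  "\<forall>i\<in>free_vars \<phi>. bs ! \<rho> i = int (e i) \<Longrightarrow> Ifm bbs bs (cooper_of_fm \<rho> \<phi>) \<longleftrightarrow> sat e \<phi>"
proof (induction \<phi> arbitrary: \<rho> bs e)
  case (Eq s t)
  then show ?case by (simp add: Inum_num_of_tm[where e = e])
next
  case (Ex i \<phi>)
  have "Ifm bbs (int n # bs) (cooper_of_fm (\<lambda>j. if j = i then 0 else Suc (\<rho> j)) \<phi>) \<longleftrightarrow>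
      sat (e(i := n)) \<phi>" for n
    using Ex.prems by (intro Ex.IH) auto
  \<comment> \<open>The guard \<open>Ge (Bound 0)\<close> leaves exactly the integers of the form
    \<open>int n\<close> as witnesses.\<close>
  then show ?case
    by simp (metis nonneg_int_cases of_nat_0_le_iff)
next
  case (Conj \<phi> \<psi>)
  show ?case using Conj.prems Conj.IH(1)[of bs \<rho> e] Conj.IH(2)[of bs \<rho> e] by (simp add: ball_Un)
next
  case (Neg \<phi>)
  show ?case using Neg.prems Neg.IH[of bs \<rho> e] by simp
qed

text \<open>With \<open>id\<close> as index map, the variables below \<open>m\<close> read the
  coordinates of \<open>c\<close> and the next \<open>m\<close> variables those of
  \<open>a\<close>.\<close>

lemma fmt_holds:
  fixes x :: "'a \<Rightarrow> nat list"
  assumes len: "\<And>a. length (x a) = m" and fv: "free_vars \<phi> \<subseteq> {..<2 * m}"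
  shows "finitely_many_types (\<lambda>a i. int (x a ! i)) m (\<lambda>c a. holds \<phi> (x c @ x a))"
proof -
  let ?env = "\<lambda>c a. map (\<lambda>i. int (x c ! i)) [0..<m] @ map (\<lambda>i. int (x a ! i)) [0..<m]"
  have "holds \<phi> (x c @ x a) \<longleftrightarrow> Ifm [] (?env c a) (cooper_of_fm id \<phi>)" for c a
    unfolding holds_def
  proof (rule Ifm_cooper_of_fm[symmetric], intro ballI)
    fix i assume "i \<in> free_vars \<phi>"
    then have "i < 2 * m" using fv by auto
    then consider "i < m" | j where "i = m + j" "j < m"
      by (metis add_less_cancel_left le_Suc_ex mult_2 not_less)
    then show "?env c a ! id i = int (if i < length (x c @ x a) then (x c @ x a) ! i else 0)"
      by cases (simp_all add: len nth_append)
  qed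
  \<comment> \<open>Cooper's procedure \<open>pa\<close> yields an equivalent quantifier-free
    formula.\<close>
  also have "Ifm [] (?env c a) (cooper_of_fm id \<phi>) \<longleftrightarrow>
      Ifm [] (?env c a) (pa (cooper_of_fm id \<phi>))" for c a
    by (simp add: mirqe)
  finally show ?thesis
    by (simp only:) (rule fmt_qfree, simp add: mirqe)
qed


section \<open>Rank and scatteredness\<close>

text \<open>On \<open>S\<close>, \<open>f\<close> factors through \<open>t\<close> by choosing a
  preimage in \<open>S\<close> of each value of \<open>t\<close>.\<close>

lemma finite_image_factor:
  assumes "finite (t ` S)" "\<And>a b. a \<in> S \<Longrightarrow> b \<in> S \<Longrightarrow> t a = t b \<Longrightarrow> f a = f b"
  shows "finite (f ` S)"
proof (rule finite_subset)
  show "f ` S \<subseteq> (\<lambda>s. f (inv_into S t s)) ` t ` S"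
  proof
    fix y assume "y \<in> f ` S"
    then obtain a where a: "a \<in> S" "y = f a" by blast
    have "f (inv_into S t (t a)) = f a"
      using a(1) by (intro assms(2)) (auto intro: inv_into_into f_inv_into_f)
    then show "y \<in> (\<lambda>s. f (inv_into S t s)) ` t ` S" using a by force
  qed
qed (use assms(1) in blast)

text \<open>This passes from single flats to finite unions: \<open>S\<close> is covered by finitely
  many flats with \<open>card I \<le> k\<close>, each with its own colour family.\<close>

lemma thin_colouring:
  assumes fmt: "finitely_many_types x m P" and thin: "thin x m (Suc k) S"
  obtains t :: "'a \<Rightarrow> 'a set set" where "finite (range t)"
    and "\<And>a b. t a = t b \<Longrightarrow> thin x m k {c \<in> S. P c a \<noteq> P c b}"
proof -
  obtain \<V> where V: "finite \<V>" "S \<subseteq> \<Union>\<V>" "\<forall>V\<in>\<V>. \<exists>I. flat x m I V \<and> card I < Suc k"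
    using thin unfolding thin_def by blast
  have "\<forall>V\<in>\<V>. \<exists>\<C>. finite \<C> \<and> (\<forall>a b. (\<forall>B\<in>\<C>. a \<in> B \<longleftrightarrow> b \<in> B) \<longrightarrow>
      thin x m k {c \<in> V. P c a \<noteq> P c b})"
  proof
    fix V assume "V \<in> \<V>"
    then obtain I where I: "flat x m I V" "card I \<le> k" using V(3) by auto
    then obtain \<C> where "finite \<C>" "\<And>a b. (\<forall>B\<in>\<C>. a \<in> B \<longleftrightarrow> b \<in> B) \<Longrightarrow>
        thin x m (card I) {c \<in> V. P c a \<noteq> P c b}"
      using fmt unfolding finitely_many_types_def by meson
    then show "\<exists>\<C>. finite \<C> \<and> (\<forall>a b. (\<forall>B\<in>\<C>. a \<in> B \<longleftrightarrow> b \<in> B) \<longrightarrow>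
        thin x m k {c \<in> V. P c a \<noteq> P c b})"
      by (intro exI[of _ \<C>] conjI allI impI thin_mono[OF _ I(2)])
  qed
  from bchoice[OF this] obtain \<C> where C: "\<forall>V\<in>\<V>. finite (\<C> V) \<and>
      (\<forall>a b. (\<forall>B\<in>\<C> V. a \<in> B \<longleftrightarrow> b \<in> B) \<longrightarrow> thin x m k {c \<in> V. P c a \<noteq> P c b})" ..
  have finC: "finite (\<C> V)" if "V \<in> \<V>" for V
    using bspec[OF C that] by (rule conjunct1)
  have thinC: "thin x m k {c \<in> V. P c a \<noteq> P c b}"
    if "V \<in> \<V>" "\<forall>B\<in>\<C> V. a \<in> B \<longleftrightarrow> b \<in> B" for V a b
    using conjunct2[OF bspec[OF C that(1)]] that(2) by (elim allE impE)
  \<comment> \<open>The type of \<open>a\<close> is the set of all colours, over all flats of the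
    cover, that contain \<open>a\<close>.\<close>
  let ?t = "\<lambda>a. {B \<in> \<Union>(\<C> ` \<V>). a \<in> B}"
  show thesis
  proof (rule that[of ?t])
    have "finite (Pow (\<Union>(\<C> ` \<V>)))" using V(1) finC by simp
    then show "finite (range ?t)" by (rule rev_finite_subset) auto
    fix a b assume eq: "?t a = ?t b"
    have "thin x m k (\<Union>V\<in>\<V>. {c \<in> V. P c a \<noteq> P c b})"
      using V(1)
    proof (rule thin_UN)
      fix V assume V: "V \<in> \<V>"
      show "thin x m k {c \<in> V. P c a \<noteq> P c b}"
        using V
      proof (rule thinC, intro ballI)
        fix B assume "B \<in> \<C> V"
        then have "B \<in> \<Union>(\<C> ` \<V>)" using V by blast
        moreover have "B \<in> ?t a \<longleftrightarrow> B \<in> ?t b" unfolding eq ..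
        ultimately show "a \<in> B \<longleftrightarrow> b \<in> B" by simp
      qed
    qed
    then show "thin x m k {c \<in> S. P c a \<noteq> P c b}"
      by (rule thin_subset) (use V(2) in auto)
  qed
qed

text \<open>A point of the half-open interval from \<open>a\<close> to \<open>b\<close> precedes
  \<open>b\<close> but not \<open>a\<close>, so the sections at \<open>a\<close> and
  \<open>b\<close> differ there. The endpoint \<open>a\<close> is included so that the interval is
  nonempty whenever \<open>a\<close> is in \<open>S\<close> and precedes \<open>b\<close>.\<close>

lemma interval_colouring:
  assumes lin: "linear_ordering L r"
    and fmt: "finitely_many_types x m P" and P: "\<And>a b. a \<in> L \<Longrightarrow> b \<in> L \<Longrightarrow> P a b \<longleftrightarrow> (a, b) \<in> r"
    and S: "S \<subseteq> L" "thin x m (Suc k) S"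
  obtains t :: "'a \<Rightarrow> 'a set set" where "finite (range t)"
    and "\<And>a b. a \<in> L \<Longrightarrow> b \<in> L \<Longrightarrow> t a = t b \<Longrightarrow>
      thin x m k {c \<in> S. (c = a \<or> (a, c) \<in> r) \<and> (c, b) \<in> r}"
proof -
  obtain t :: "'a \<Rightarrow> 'a set set" where t: "finite (range t)"
    "\<And>a b. t a = t b \<Longrightarrow> thin x m k {c \<in> S. P c a \<noteq> P c b}"
    using thin_colouring[OF fmt S(2)] by blast
  have "(c, a) \<notin> r" if "c = a \<or> (a, c) \<in> r" for a c
    using lin that unfolding linear_ordering_def strict_linear_order_on_def trans_def irrefl_def
    by blast
  then have sub: "{c \<in> S. (c = a \<or> (a, c) \<in> r) \<and> (c, b) \<in> r} \<subseteq> {c \<in> S. P c a \<noteq> P c b}"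
    if "a \<in> L" "b \<in> L" for a b
    using that S(1) P by blast
  show thesis
    by (rule that[OF t(1)]) (rule thin_subset[OF t(2) sub])
qed

section \<open>Rank bound for convex thin sets\<close>

text \<open>Induction on the dimension bound \<open>k\<close>. Between two equally coloured points
  of a convex set the interval is convex of dimension below that bound, so it meets finitely many
  classes of the previous level and the two points are equivalent at the next one. Hence there are
  at most as many classes as colours.\<close>

lemma finite_quotient_vd_eq:
  assumes lin: "linear_ordering L r"
    and fmt: "finitely_many_types x m P" and P: "\<And>a b. a \<in> L \<Longrightarrow> b \<in> L \<Longrightarrow> P a b \<longleftrightarrow> (a, b) \<in> r"
  shows "S \<subseteq> L \<Longrightarrow> (\<And>a b. a \<in> S \<Longrightarrow> b \<in> S \<Longrightarrow> between L r a b \<subseteq> S) \<Longrightarrow> thin x m (Suc k) S \<Longrightarrow>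
    finite (S // vd_eq L r (ord_of_nat k))"
proof (induction k arbitrary: S)
  case (0 S)
  obtain t :: "'a \<Rightarrow> 'a set set" where t: "finite (range t)"
    "\<And>a b. a \<in> L \<Longrightarrow> b \<in> L \<Longrightarrow> t a = t b \<Longrightarrow>
      thin x m 0 {c \<in> S. (c = a \<or> (a, c) \<in> r) \<and> (c, b) \<in> r}"
    using interval_colouring[OF lin fmt P 0(1,3)] by blast
  have "a = b" if "a \<in> S" "b \<in> S" "t a = t b" for a b
  proof -
    \<comment> \<open>Both half-open intervals are empty, yet each would contain its left endpoint
      if its endpoints were in increasing order.\<close>
    have "(a, b) \<notin> r" "(b, a) \<notin> r"
      using t(2)[of a b] t(2)[of b a] that 0(1) unfolding thin_0 by auto
    moreover have "total_on L r"
      using lin by (simp add: linear_ordering_def strict_linear_order_on_def)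
    ultimately show ?thesis using that 0(1) unfolding total_on_def by blast
  qed
  then have "inj_on t S" by (intro inj_onI)
  moreover have "finite (t ` S)" using t(1) by (rule rev_finite_subset) auto
  ultimately have "finite S" by (metis finite_imageD)
  then show ?case unfolding quotient_def by simp
next
  case (Suc k S)
  let ?J = "\<lambda>a b. {c \<in> S. (c = a \<or> (a, c) \<in> r) \<and> (c, b) \<in> r}"
  let ?E = "vd_eq L r (ord_of_nat (Suc k))"
  have equiv: "equiv L ?E" using vd_eq_properties[OF lin] by blast
  have tr: "trans r" and irr: "irrefl r" and tot: "total_on L r"
    using lin by (auto simp: linear_ordering_def strict_linear_order_on_def)
  obtain t :: "'a \<Rightarrow> 'a set set" where t: "finite (range t)"
    "\<And>a b. a \<in> L \<Longrightarrow> b \<in> L \<Longrightarrow> t a = t b \<Longrightarrow> thin x m (Suc k) (?J a b)"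
    using interval_colouring[OF lin fmt P Suc.prems(1,3)] by blast
  have less: "(a, b) \<in> ?E" if ab: "a \<in> S" "b \<in> S" "t a = t b" "(a, b) \<in> r" for a b
  proof -
    have "finite (?J a b // vd_eq L r (ord_of_nat k))"
    proof (rule Suc.IH)
      show "between L r c d \<subseteq> ?J a b" if "c \<in> ?J a b" "d \<in> ?J a b" for c d
      proof -
        have "between L r c d \<subseteq> S" using that by (intro Suc.prems(2)) auto
        moreover have "between L r c d \<subseteq> {c. (c = a \<or> (a, c) \<in> r) \<and> (c, b) \<in> r}"
          using that tr unfolding between_def trans_def by blast
        ultimately show ?thesis by blast
      qed
    qed (use Suc.prems(1) ab in \<open>auto intro: t(2)\<close>)
    \<comment> \<open>Convexity of \<open>S\<close> puts all of \<open>between L r a b\<close>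
      inside \<open>S\<close>, so finiteness carries over from \<open>?J a b\<close>.\<close>
    moreover have "between L r a b \<subseteq> ?J a b"
    proof -
      have "(b, c) \<notin> r \<or> (c, a) \<notin> r" for c
        using ab(4) tr irr unfolding trans_def irrefl_def by blast
      then show ?thesis
        using Suc.prems(2)[OF ab(1,2)] unfolding between_def by blast
    qed
    ultimately have "finite (between L r a b // vd_eq L r (ord_of_nat k))"
      by (rule finite_quotient_subset[rotated])
    then show ?thesis
      using ab Suc.prems(1) by (auto simp: vd_eq_succ)
  qed
  have same: "?E `` {a} = ?E `` {b}" if ab: "a \<in> S" "b \<in> S" "t a = t b" for a b
  proof -
    consider "a = b" | "(a, b) \<in> r" | "(b, a) \<in> r"
      using tot ab Suc.prems(1) unfolding total_on_def by blast
    then show ?thesis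
    proof cases
      case 2
      then show ?thesis using less ab by (intro equiv_class_eq[OF equiv]) auto
    next
      case 3
      then show ?thesis using less ab by (intro equiv_class_eq[OF equiv, symmetric]) auto
    qed simp
  qed
  have "finite (t ` S)" using t(1) by (rule rev_finite_subset) auto
  then have "finite ((\<lambda>a. ?E `` {a}) ` S)"
    by (rule finite_image_factor) (rule same)
  moreover have "S // ?E = (\<lambda>a. ?E `` {a}) ` S" by (auto simp: quotient_def)
  ultimately show ?case by metis
qed

section \<open>Dense suborders of thin sets\<close>

text \<open>If \<open>S\<close> were finite, descending from \<open>b\<close> towards
  \<open>a\<close> would reach an immediate successor of \<open>a\<close> in \<open>S\<close>,
  against density.\<close>

lemma dense_on_infinite:
  assumes "linear_ordering L r" "S \<subseteq> L" "dense_on S r" "a \<in> S" "b \<in> S" "(a, b) \<in> r"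
  shows "infinite S"
proof
  assume fin: "finite S"
  have tr: "trans r" and irr: "irrefl r"
    using assms(1) by (auto simp: linear_ordering_def strict_linear_order_on_def)
  let ?J = "\<lambda>b. {c \<in> S. (a, c) \<in> r \<and> (c, b) \<in> r}"
  have "\<exists>c\<in>S. (a, c) \<in> r \<and> ?J c = {}"
    using assms(5,6)
  proof (induction "card (?J b)" arbitrary: b rule: less_induct)
    case less
    show ?case
    proof (cases "?J b = {}")
      case False
      then obtain c where c: "c \<in> ?J b" by blast
      then have "?J c \<subseteq> ?J b" "c \<notin> ?J c"
        using tr irr unfolding trans_def irrefl_def by blast+
      then have "?J c \<subset> ?J b" using c by blast
      then have "card (?J c) < card (?J b)" using fin by (intro psubset_card_mono) auto
      then show ?thesis using less(1)[of c] c by blast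
    qed (use less.prems in blast)
  qed
  then show False
    using assms(3,4) unfolding dense_on_def by blast
qed

text \<open>Induction on \<open>k\<close>: a comparable pair makes \<open>S\<close> infinite, and
  then an interval between two equally coloured points is a dense set of lower dimension that again
  contains a comparable pair.\<close>

lemma thin_dense_on:
  assumes lin: "linear_ordering L r"
    and fmt: "finitely_many_types x m P" and P: "\<And>a b. a \<in> L \<Longrightarrow> b \<in> L \<Longrightarrow> P a b \<longleftrightarrow> (a, b) \<in> r"
  shows "S \<subseteq> L \<Longrightarrow> thin x m k S \<Longrightarrow> dense_on S r \<Longrightarrow> a \<in> S \<Longrightarrow> b \<in> S \<Longrightarrow> (a, b) \<notin> r"
proof (induction k arbitrary: S a b)
  case 0
  then show ?case by (simp add: thin_0)
next
  case (Suc k S)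
  let ?J = "\<lambda>a b. {c \<in> S. (c = a \<or> (a, c) \<in> r) \<and> (c, b) \<in> r}"
  have tr: "trans r" and tot: "total_on L r"
    using lin by (auto simp: linear_ordering_def strict_linear_order_on_def)
  obtain t :: "'a \<Rightarrow> 'a set set" where t: "finite (range t)"
    "\<And>a b. a \<in> L \<Longrightarrow> b \<in> L \<Longrightarrow> t a = t b \<Longrightarrow> thin x m k (?J a b)"
    using interval_colouring[OF lin fmt P Suc.prems(1,2)] by blast
  show ?case
  proof
    assume "(a, b) \<in> r"
    then have "infinite S"
      using dense_on_infinite[OF lin Suc.prems(1,3-5)] by blast
    moreover have "finite (t ` S)" using t(1) by (rule rev_finite_subset) auto
    \<comment> \<open>Pigeonhole: infinitely many points share finitely many colours.\<close>
    ultimately have "\<not> inj_on t S" by (metis finite_imageD)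
    then obtain u v where uv: "u \<in> S" "v \<in> S" "t u = t v" "(u, v) \<in> r"
      using tot Suc.prems(1) unfolding inj_on_def total_on_def by (metis subsetD)
    then obtain w where w: "w \<in> S" "(u, w) \<in> r" "(w, v) \<in> r"
      using Suc.prems(3) unfolding dense_on_def by blast
    \<comment> \<open>The half-open interval contains both \<open>u\<close> and \<open>w\<close>, so
      the induction hypothesis applies to this pair.\<close>
    have "(u, w) \<notin> r"
    proof (rule Suc.IH)
      show "thin x m k (?J u v)" using uv Suc.prems(1) by (intro t(2)) auto
      show "dense_on (?J u v) r"
        unfolding dense_on_def
      proof (intro ballI impI)
        fix c d assume cd: "c \<in> ?J u v" "d \<in> ?J u v" "(c, d) \<in> r"
        then obtain z where "z \<in> S" "(c, z) \<in> r" "(z, d) \<in> r"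
          using Suc.prems(3) unfolding dense_on_def by blast
        then show "\<exists>z\<in>?J u v. (c, z) \<in> r \<and> (z, d) \<in> r"
          using cd tr unfolding trans_def by blast
      qed
    qed (use Suc.prems(1) uv w in auto)
    then show False using w by simp
  qed
qed

section \<open>From interpretations to tuples\<close>

text \<open>Each element of \<open>L\<close> receives a tuple from its class. As
  \<open>less_fm\<close> respects the interpreted equality, its truth does not depend on the
  choice.\<close>

lemma interpretable_representatives:
  assumes "interpretable_in_nat_plus m L r"
  obtains x :: "'a \<Rightarrow> nat list" and \<phi> where "\<And>a. length (x a) = m" "free_vars \<phi> \<subseteq> {..<2 * m}"
    "\<And>a b. a \<in> L \<Longrightarrow> b \<in> L \<Longrightarrow> holds \<phi> (x a @ x b) \<longleftrightarrow> (a, b) \<in> r"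
proof -
  obtain \<iota> h where \<iota>: "is_interpretation m \<iota>" and h: "bij_betw h L (internal_carrier m \<iota>)"
    "\<And>a b. a \<in> L \<Longrightarrow> b \<in> L \<Longrightarrow> (a, b) \<in> r \<longleftrightarrow> (h a, h b) \<in> internal_less m \<iota>"
    using assms unfolding interpretable_in_nat_plus_def order_isomorphic_def by blast
  let ?D = "interp_dom m \<iota>" and ?E = "interp_eq m \<iota>"
  have eqv: "equiv ?D ?E"
    and resp: "(\<lambda>xs ys. holds (less_fm \<iota>) (xs @ ys)) respects2 ?E"
    and fv: "free_vars (less_fm \<iota>) \<subseteq> {..<2 * m}"
    using \<iota> by (auto simp: is_interpretation_def)
  have "\<exists>xs\<in>?D. h a = ?E `` {xs}" if "a \<in> L" for a
    using bij_betwE[OF h(1)] that by (auto simp: internal_carrier_def elim!: quotientE)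
  then obtain y where y: "\<And>a. a \<in> L \<Longrightarrow> y a \<in> ?D" "\<And>a. a \<in> L \<Longrightarrow> h a = ?E `` {y a}"
    by metis
  \<comment> \<open>The zero tuple outside \<open>L\<close> gives every value length
    \<open>m\<close>, as \<open>fmt_holds\<close> demands.\<close>
  let ?x = "\<lambda>a. if a \<in> L then y a else replicate m 0"
  show thesis
  proof (rule that[of ?x "less_fm \<iota>"])
    show "length (?x a) = m" for a using y(1) by (simp add: interp_dom_def)
    fix a b assume ab: "a \<in> L" "b \<in> L"
    have "holds (less_fm \<iota>) (y a @ y b)" if "(a, b) \<in> r"
    proof -
      have internal: "(?E `` {y a}, ?E `` {y b}) \<in> internal_less m \<iota>"
        using that h(2)[OF ab] y(2)[OF ab(1)] y(2)[OF ab(2)] by simp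
      obtain xs ys where xy: "?E `` {y a} = ?E `` {xs}" "?E `` {y b} = ?E `` {ys}" "xs \<in> ?D" "ys \<in> ?D"
        "holds (less_fm \<iota>) (xs @ ys)"
        using internal unfolding internal_less_def by blast
      then have "(xs, y a) \<in> ?E" "(ys, y b) \<in> ?E"
        using y(1) ab by (auto intro: eq_equiv_class[OF _ eqv])
      then show ?thesis using congruent2D[OF resp] xy(5) by blast
    qed
    moreover have "(a, b) \<in> r" if "holds (less_fm \<iota>) (y a @ y b)"
      using that ab y h(2) unfolding internal_less_def by blast
    ultimately show "holds (less_fm \<iota>) (?x a @ ?x b) \<longleftrightarrow> (a, b) \<in> r"
      using ab by auto
  qed (rule fv)
qed

theorem theorem1p3:
  fixes L :: "'a set" and r :: "'a rel" and m :: nat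
  assumes "linear_ordering L r"
    and "m \<ge> 1"
    and "interpretable_in_nat_plus m L r"
  shows "scattered L r \<and> vd_rank L r \<le> Fin (ord_of_nat m)"
proof
  obtain x :: "'a \<Rightarrow> nat list" and \<phi> where x: "\<And>a. length (x a) = m" "free_vars \<phi> \<subseteq> {..<2 * m}"
    and less: "\<And>a b. a \<in> L \<Longrightarrow> b \<in> L \<Longrightarrow> holds \<phi> (x a @ x b) \<longleftrightarrow> (a, b) \<in> r"
    using interpretable_representatives[OF assms(3)] by blast
  note fmt = fmt_holds[OF x]
  \<comment> \<open>All \<open>m\<close> coordinates together form a flat, so every set has
    dimension at most \<open>m\<close>.\<close>
  have thin: "thin (\<lambda>a i. int (x a ! i)) m (Suc m) S" for S
    by (rule thin_flat[OF flat_all_coordinates]) simp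
  show "scattered L r"
    unfolding scattered_def
  proof clarify
    fix S assume S: "S \<subseteq> L" "infinite S" "dense_on S r"
    then obtain a where a: "a \<in> S" by (metis finite.emptyI equals0I)
    obtain b where b: "b \<in> S" "b \<noteq> a"
      using S(2) by (metis finite.emptyI finite_insert finite_subset insertI1 subsetI)
    \<comment> \<open>Two distinct points would be incomparable, contradicting totality.\<close>
    have "(a, b) \<notin> r" "(b, a) \<notin> r"
      using thin_dense_on[OF assms(1) fmt less S(1) thin S(3)] a b by blast+
    then show False
      using assms(1) a b S(1)
      unfolding linear_ordering_def strict_linear_order_on_def total_on_def by blast
  qed
  \<comment> \<open>\<open>L\<close> is convex in itself, so the rank bound applies with
    \<open>k = m\<close>.\<close>
  have "finite (L // vd_eq L r (ord_of_nat m))"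
    by (rule finite_quotient_vd_eq[OF assms(1) fmt less _ _ thin]) (auto simp: between_def)
  then show "vd_rank L r \<le> Fin (ord_of_nat m)"
    unfolding vd_rank_def by (auto intro: Least_le)
qed

end
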